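(* Let $G$ be an $\alpha$-weakly-Helly graph and $M\subseteq V(G)$. For every $x\in V(G)$ and every $y\in F_G^M(x)$, $$e_G^M(y)\ge 2rad_G(M)-diam_G(C_G^{2\alpha}(M))-2\alpha\quad\text{and}\quad e_G^M(y)\ge 2rad_G(M)-diam_G(C_G^{\alpha}(M))-4\alpha.$$
   Context: All graphs are finite, simple, undirected, unweighted and connected. A graph $G$ is $\alpha$-weakly-Helly if for every family of pairwise intersecting disks $\{D_G(v,r(v)) : v\in S\}$ (where $D_G(v,r)=\{u: d_G(u,v)\le r\}$) the disks $D_G(v,r(v)+\alpha)$, $v\in S$, have a common vertex. For $M\subseteq V(G)$ and $v\in V(G)$: $e_G^M(v)=\max_{u\in M}d_G(v,u)$, $F_G^M(v)=\{u\in M: d_G(v,u)=e_G^M(v)\}$, $rad_G(M)=\min_{v\in V(G)}e_G^M(v)$, $C_G^{\ell}(M)=\{v: e_G^M(v)\le rad_G(M)+\ell\}$, and for $S\subseteq V(G)$, $diam_G(S)=\max_{u,v\in S}d_G(u,v)$. *)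

theory Defs
  imports "Graph_Theory.Graph_Theory"
begin

text \<open>
  Finite simple undirected graphs are the loop-free symmetric digraphs without parallel arcs of
  locale \<open>graph\<close>; an undirected edge is a pair of opposite arcs. Distances, eccentricities, radius
  and diameter are natural numbers. They are meaningful only on a connected graph and for nonempty
  vertex sets, since \<open>LEAST\<close>, \<open>Max\<close> and \<open>Min\<close> are otherwise unspecified.
\<close>

definition graph_dist :: "('a, 'b) pre_digraph \<Rightarrow> 'a \<Rightarrow> 'a \<Rightarrow> nat" where
  "graph_dist G u v = (LEAST n. \<exists>p. pre_digraph.awalk G u p v \<and> length p = n)"

lemma (in wf_digraph) graph_dist_eq_unit_weight_distance:
  assumes "u \<rightarrow>\<^sup>*\<^bsub>G\<^esub> v"
  shows "ereal (real (graph_dist G u v)) = \<mu> (\<lambda>_. 1) u v"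
proof -
  have cost: "awalk_cost (\<lambda>_. 1) p = real (length p)" for p :: "'b list"
    by (induct p) simp_all
  have "\<exists>n p. awalk u p v \<and> length p = n"
    using assms by (auto simp: reachable_awalk)
  then have "\<exists>p. awalk u p v \<and> length p = graph_dist G u v"
    unfolding graph_dist_def by (rule LeastI_ex)
  then obtain p where p: "awalk u p v" "length p = graph_dist G u v" by blast
  have least: "graph_dist G u v \<le> length q" if "awalk u q v" for q
    unfolding graph_dist_def using that by (intro Least_le) blast
  show ?thesis
  proof (rule antisym)
    show "ereal (real (graph_dist G u v)) \<le> \<mu> (\<lambda>_. 1) u v"
      unfolding \<mu>_def by (rule INF_greatest) (simp add: cost least)
    show "\<mu> (\<lambda>_. 1) u v \<le> ereal (real (graph_dist G u v))"
      using min_cost_le_walk_cost[OF p(1), of "\<lambda>_. 1"] p(2) by (simp add: cost)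
  qed
qed

text \<open>
  The increment \<open>\<alpha>\<close> and the level \<open>l\<close> are real numbers, which covers integer and half-integer
  values alike; the radii of a given family of disks are natural numbers.
\<close>

definition disk :: "('a, 'b) pre_digraph \<Rightarrow> 'a \<Rightarrow> real \<Rightarrow> 'a set" where
  "disk G v r = {u \<in> verts G. real (graph_dist G u v) \<le> r}"

text \<open>A negative \<open>\<alpha>\<close> never satisfies the following, as a single disk of radius \<open>0\<close> shows.\<close>

definition weakly_Helly :: "real \<Rightarrow> ('a, 'b) pre_digraph \<Rightarrow> bool" where
  "weakly_Helly \<alpha> G \<longleftrightarrow>
    (\<forall>S (r :: 'a \<Rightarrow> nat). S \<subseteq> verts G \<and>
        (\<forall>u\<in>S. \<forall>v\<in>S. disk G u (real (r u)) \<inter> disk G v (real (r v)) \<noteq> {}) \<longrightarrow>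
      (\<exists>w\<in>verts G. \<forall>v\<in>S. w \<in> disk G v (real (r v) + \<alpha>)))"

definition ecc :: "('a, 'b) pre_digraph \<Rightarrow> 'a set \<Rightarrow> 'a \<Rightarrow> nat" where
  "ecc G M v = Max (graph_dist G v ` M)"

definition farthest :: "('a, 'b) pre_digraph \<Rightarrow> 'a set \<Rightarrow> 'a \<Rightarrow> 'a set" where
  "farthest G M v = {u \<in> M. graph_dist G v u = ecc G M v}"

definition rad :: "('a, 'b) pre_digraph \<Rightarrow> 'a set \<Rightarrow> nat" where
  "rad G M = Min (ecc G M ` verts G)"

definition center :: "('a, 'b) pre_digraph \<Rightarrow> real \<Rightarrow> 'a set \<Rightarrow> 'a set" where
  "center G l M = {v \<in> verts G. real (ecc G M v) \<le> real (rad G M) + l}"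

definition diam :: "('a, 'b) pre_digraph \<Rightarrow> 'a set \<Rightarrow> nat" where
  "diam G S = Max {graph_dist G u v | u v. u \<in> S \<and> v \<in> S}"

end

(*
  Put r = rad(M). For any vertex z (so e(z) >= r), the disks D(u, r) (u in M) together with
  D(z, e(z) - r) intersect pairwise, so the weak Helly property yields a vertex c in
  C^alpha(M) with d(c, z) <= e(z) - r + alpha. Taking z = x and z = y gives two vertices of
  C^alpha(M), at distance at least d(x, y) - (e(x) - r + alpha) - (e(y) - r + alpha)
  = 2r - e(y) - 2 alpha. This bound, stronger than both claims, implies them because
  C^alpha(M) is contained in C^(2 alpha)(M) and alpha >= 0.
*)

theory Submission
  imports Defs
begin

lemma (in wf_digraph) graph_dist_le_awalk_length:
  assumes "awalk u p v"
  shows "graph_dist G u v \<le> length p"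
  unfolding graph_dist_def using assms by (intro Least_le) blast

lemma (in wf_digraph) graph_dist_self: "v \<in> verts G \<Longrightarrow> graph_dist G v v = 0"
  using graph_dist_le_awalk_length[of v "[]" v] by (simp add: awalk_Nil_iff)

text \<open>Reverse the order of the arcs and replace each by its opposite, which exists by
  symmetry. This makes \<open>graph_dist\<close>, which counts arcs of directed walks,
  symmetric.\<close>

lemma (in sym_digraph) awalk_reverse:
  assumes "awalk u p v"
  shows "\<exists>q. awalk v q u \<and> length q = length p"
  using assms
proof (induct p arbitrary: u)
  case Nil
  then show ?case by (auto simp: awalk_Nil_iff)
next
  case (Cons e p)
  from Cons.prems have e: "e \<in> arcs G" "u = tail G e" and p: "awalk (head G e) p v"
    by (simp_all add: awalk_Cons_iff)
  obtain q where q: "awalk v q (head G e)" "length q = length p"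
    using Cons.hyps[OF p] by blast
  obtain e' where e': "e' \<in> arcs G" "tail G e = head G e'" "head G e = tail G e'"
    using sym_arcs e(1) unfolding symmetric_conv by blast
  have "awalk (head G e) [e'] u"
    using e e' by (simp add: awalk_simps)
  then have "awalk v (q @ [e']) u"
    using q(1) by (rule awalk_appendI[rotated])
  with q(2) show ?case
    by (intro exI[of _ "q @ [e']"]) simp
qed

locale connected_graph = graph +
  assumes conn: "Digraph_Component.connected G"
begin

lemma shortest_awalk:
  assumes "u \<in> verts G" "v \<in> verts G"
  obtains p where "awalk u p v" "length p = graph_dist G u v"
proof -
  \<comment> \<open>Connectedness provides a walk in the symmetric closure only; since
    \<open>G\<close> is symmetric, it can be turned into a walk of \<open>G\<close>.\<close>
  have "\<exists>n p. awalk u p v \<and> length p = n"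
    using connected_awalkE[OF conn assms] mk_symmetric_awalk_imp_awalk[OF sym_arcs] by metis
  then have "\<exists>p. awalk u p v \<and> length p = graph_dist G u v"
    unfolding graph_dist_def by (rule LeastI_ex)
  then show ?thesis using that by blast
qed

lemma graph_dist_triangle:
  assumes "u \<in> verts G" "v \<in> verts G" "w \<in> verts G"
  shows "graph_dist G u w \<le> graph_dist G u v + graph_dist G v w"
proof -
  obtain p where p: "awalk u p v" "length p = graph_dist G u v"
    using assms(1,2) by (rule shortest_awalk)
  obtain q where q: "awalk v q w" "length q = graph_dist G v w"
    using assms(2,3) by (rule shortest_awalk)
  show ?thesis
    using graph_dist_le_awalk_length[OF awalk_appendI[OF p(1) q(1)]] p(2) q(2) by simp
qed

lemma graph_dist_commute:
  assumes "u \<in> verts G" "v \<in> verts G"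
  shows "graph_dist G u v = graph_dist G v u"
proof -
  have "graph_dist G a b \<le> graph_dist G b a" if ab: "a \<in> verts G" "b \<in> verts G" for a b
  proof -
    obtain p where p: "awalk b p a" "length p = graph_dist G b a"
      using ab(2,1) by (rule shortest_awalk)
    obtain q where "awalk a q b" "length q = length p"
      using awalk_reverse[OF p(1)] by blast
    then show ?thesis
      using graph_dist_le_awalk_length[of a q b] p(2) by simp
  qed
  with assms show ?thesis by (intro antisym)
qed

text \<open>A shortest walk cut after \<open>i\<close> arcs passes through a common vertex. This
  reduces the pairwise intersections required by the weak Helly property to inequalities between
  distances.\<close>

lemma disks_meet:
  assumes "u \<in> verts G" "v \<in> verts G" "graph_dist G u v \<le> i + j"
  shows "disk G u (real i) \<inter> disk G v (real j) \<noteq> {}"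
proof -
  obtain p where p: "awalk u p v" "length p = graph_dist G u v"
    using assms(1,2) by (rule shortest_awalk)
  \<comment> \<open>If \<open>p\<close> has at most \<open>i\<close> arcs, \<open>take i p\<close>
    is all of \<open>p\<close> and \<open>w\<close> is \<open>v\<close>.\<close>
  define w where "w = awlast u (take i p)"
  have "awalk u (take i p @ drop i p) v"
    using p(1) by simp
  then have up: "awalk u (take i p) w" and dn: "awalk w (drop i p) v"
    unfolding w_def awalk_append_iff by blast+
  have w: "w \<in> verts G" using up by (rule awalk_last_in_verts)
  have "graph_dist G w u \<le> i"
    using graph_dist_le_awalk_length[OF up] graph_dist_commute[OF w assms(1)] by simp
  moreover have "graph_dist G w v \<le> j"
    using graph_dist_le_awalk_length[OF dn] p(2) assms(3) by simp
  ultimately have "w \<in> disk G u (real i) \<inter> disk G v (real j)"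
    using w by (simp add: disk_def)
  then show ?thesis by blast
qed

text \<open>Apply the property to the single disk of radius 0 at \<open>v\<close>: its enlargement
  by \<alpha> contains a vertex, whereas a disk of negative radius is empty.\<close>

lemma weakly_Helly_nonneg:
  assumes "weakly_Helly \<alpha> G" "v \<in> verts G"
  shows "0 \<le> \<alpha>"
proof -
  have "disk G v (real 0) \<inter> disk G v (real 0) \<noteq> {}"
    using disks_meet[of v v 0 0] graph_dist_self assms(2) by simp
  then obtain w where "w \<in> disk G v (real 0 + \<alpha>)"
    using assms unfolding weakly_Helly_def by (elim allE[of _ "{v}"] allE[of _ "\<lambda>_. 0"]) auto
  then show ?thesis by (auto simp: disk_def)
qed

context
  fixes M :: "'a set"
  assumes M: "M \<subseteq> verts G" "M \<noteq> {}"
begin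

lemma finite_M: "finite M"
  using M(1) by (rule finite_subset) simp

lemma graph_dist_le_ecc: "u \<in> M \<Longrightarrow> graph_dist G v u \<le> ecc G M v"
  unfolding ecc_def using finite_M by (intro Max_ge) auto

lemma ecc_attained: "\<exists>u\<in>M. graph_dist G v u = ecc G M v"
proof -
  have "ecc G M v \<in> graph_dist G v ` M"
    unfolding ecc_def using finite_M M(2) by (intro Max_in) auto
  then show ?thesis by auto
qed

lemma rad_le_ecc: "v \<in> verts G \<Longrightarrow> rad G M \<le> ecc G M v"
  unfolding rad_def by (intro Min_le) auto

lemma rad_attained: "\<exists>v\<in>verts G. ecc G M v = rad G M"
proof -
  have "rad G M \<in> ecc G M ` verts G"
    unfolding rad_def using M by (intro Min_in) auto
  then show ?thesis by auto
qed

text \<open>Go through a vertex \<open>c\<close> of minimum eccentricity. Hence the disks of radius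
  \<open>rad G M\<close> around the vertices of \<open>M\<close> meet pairwise.\<close>

lemma graph_dist_le_twice_rad:
  assumes "u \<in> M" "v \<in> M"
  shows "graph_dist G u v \<le> rad G M + rad G M"
proof -
  obtain c where c: "c \<in> verts G" "ecc G M c = rad G M"
    using rad_attained by blast
  have uv: "u \<in> verts G" "v \<in> verts G" using assms M(1) by blast+
  have "graph_dist G u v \<le> graph_dist G c u + graph_dist G c v"
    using graph_dist_triangle[OF uv(1) c(1) uv(2)] graph_dist_commute[OF uv(1) c(1)] by simp
  then show ?thesis
    using graph_dist_le_ecc[OF assms(1), of c] graph_dist_le_ecc[OF assms(2), of c] c(2) by simp
qed

lemma center_near_vertex:
  assumes H: "weakly_Helly \<alpha> G" and z: "z \<in> verts G"
  shows "\<exists>c\<in>center G \<alpha> M.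
    real (graph_dist G c z) \<le> real (ecc G M z) - real (rad G M) + \<alpha>"
proof -
  let ?R = "rad G M"
  \<comment> \<open>When \<open>z\<close> lies in \<open>M\<close>, it gets a single radius, the one
    prescribed for \<open>z\<close>. The natural-number subtraction does not truncate, by
    \<open>Rz\<close> below.\<close>
  define r where "r = (\<lambda>v. if v = z then ecc G M z - ?R else ?R)"
  have Rz: "?R \<le> ecc G M z" using z by (rule rad_le_ecc)
  \<comment> \<open>The two radii add up to exactly \<open>ecc G M z\<close>, which bounds the
    distance from \<open>z\<close> to any vertex of \<open>M\<close>.\<close>
  have z_near: "graph_dist G u z \<le> r u + r z" if "u \<in> M" "u \<noteq> z" for u
    using graph_dist_le_ecc[OF that(1), of z] graph_dist_commute[of z u] z M(1) that Rz
    by (auto simp: r_def)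
  have meet: "disk G u (real (r u)) \<inter> disk G v (real (r v)) \<noteq> {}"
    if "u \<in> insert z M" "v \<in> insert z M" for u v
  proof (rule disks_meet)
    show uv: "u \<in> verts G" "v \<in> verts G" using that z M(1) by blast+
    show "graph_dist G u v \<le> r u + r v"
    proof (cases "u = v")
      case True
      then show ?thesis using graph_dist_self uv by simp
    next
      case False
      then show ?thesis
        using that z_near[of u] z_near[of v] graph_dist_commute[OF uv]
          graph_dist_le_twice_rad[of u v]
        by (cases "u = z"; cases "v = z") (auto simp: r_def)
    qed
  qed
  obtain c where c: "c \<in> verts G" "\<forall>v\<in>insert z M. c \<in> disk G v (real (r v) + \<alpha>)"
    using H meet z M(1) unfolding weakly_Helly_def
    by (elim allE[of _ "insert z M"] allE[of _ r]) auto
  \<comment> \<open>If \<open>z \<in> M\<close>, the radius at \<open>z\<close> is still at most \<open>rad G M\<close>, since then \<open>ecc G M z\<close> is a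
    distance between two points of \<open>M\<close>.\<close>
  have r_le: "r u \<le> ?R" if "u \<in> M" for u
    using ecc_attained[of z] graph_dist_le_twice_rad that by (fastforce simp: r_def)
  \<comment> \<open>For membership of \<open>c\<close> in the center, it suffices to look at the
    enlarged disk around one vertex of \<open>M\<close> farthest from \<open>c\<close>.\<close>
  obtain u where u: "u \<in> M" "graph_dist G c u = ecc G M c"
    using ecc_attained by blast
  have "real (ecc G M c) \<le> real (r u) + \<alpha>"
    using c(2) u by (auto simp: disk_def)
  also have "\<dots> \<le> real ?R + \<alpha>"
    using r_le[OF u(1)] by simp
  finally have "c \<in> center G \<alpha> M"
    using c(1) by (simp add: center_def)
  moreover have "real (graph_dist G c z) \<le> real (ecc G M z) - real ?R + \<alpha>"
    using c(2) Rz by (auto simp: disk_def r_def of_nat_diff)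
  ultimately show ?thesis by blast
qed

end

lemma graph_dist_le_diam:
  assumes "S \<subseteq> verts G" "u \<in> S" "v \<in> S"
  shows "graph_dist G u v \<le> diam G S"
proof -
  have "finite S" using assms(1) by (rule finite_subset) simp
  then have "finite {graph_dist G u v |u v. u \<in> S \<and> v \<in> S}"
    by (rule finite_image_set2[of "\<lambda>u. u \<in> S" "\<lambda>v. v \<in> S", simplified])
  then show ?thesis
    unfolding diam_def using assms(2,3) by (intro Max_ge) auto
qed

text \<open>Raising the level above \<alpha> only enlarges the center, so a free level
  \<open>l\<close> serves both claimed bounds.\<close>

lemma ecc_farthest_ge:
  assumes H: "weakly_Helly \<alpha> G" and M: "M \<subseteq> verts G"
    and x: "x \<in> verts G" and y: "y \<in> farthest G M x"
    and l: "\<alpha> \<le> l"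
  shows "real (ecc G M y) \<ge> 2 * real (rad G M) - real (diam G (center G l M)) - 2 * \<alpha>"
proof -
  have yM: "y \<in> M" and dxy: "graph_dist G x y = ecc G M x"
    using y by (auto simp: farthest_def)
  \<comment> \<open>The vertex \<open>y\<close> itself witnesses that \<open>M\<close> is
    nonempty.\<close>
  have ne: "M \<noteq> {}" and yv: "y \<in> verts G" using yM M by auto
  obtain a where a: "a \<in> center G \<alpha> M"
      "real (graph_dist G a x) \<le> real (ecc G M x) - real (rad G M) + \<alpha>"
    using center_near_vertex[OF M ne H x] by blast
  obtain b where b: "b \<in> center G \<alpha> M"
      "real (graph_dist G b y) \<le> real (ecc G M y) - real (rad G M) + \<alpha>"
    using center_near_vertex[OF M ne H yv] by blast
  have abv: "a \<in> verts G" "b \<in> verts G" using a(1) b(1) by (auto simp: center_def)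
  \<comment> \<open>The left side is \<open>ecc G M x\<close>, so this term cancels against the one
    in the bound on the distance from \<open>a\<close> to \<open>x\<close>.\<close>
  have "graph_dist G x y \<le> graph_dist G a x + graph_dist G a b + graph_dist G b y"
    using graph_dist_triangle[OF x abv(1) yv] graph_dist_triangle[OF abv yv]
      graph_dist_commute[OF x abv(1)] by simp
  moreover have "graph_dist G a b \<le> diam G (center G l M)"
    using a(1) b(1) l by (intro graph_dist_le_diam) (auto simp: center_def)
  ultimately show ?thesis
    using a(2) b(2) dxy by linarith
qed

end

theorem theorem6:
  fixes G :: "('a, 'b) pre_digraph" and \<alpha> :: real and M :: "'a set" and x y :: 'a
  assumes "graph G" and "Digraph_Component.connected G"
    and "weakly_Helly \<alpha> G"
    and "M \<subseteq> verts G"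
    and "x \<in> verts G" and "y \<in> farthest G M x"
  shows "real (ecc G M y) \<ge> 2 * real (rad G M) - real (diam G (center G (2 * \<alpha>) M)) - 2 * \<alpha> \<and>
         real (ecc G M y) \<ge> 2 * real (rad G M) - real (diam G (center G \<alpha> M)) - 4 * \<alpha>"
proof -
  interpret connected_graph G
    using assms(1,2) by (intro connected_graph.intro connected_graph_axioms.intro)
  have "0 \<le> \<alpha>" using assms(3,5) by (rule weakly_Helly_nonneg)
  \<comment> \<open>Level \<open>2 * \<alpha>\<close> gives the first bound as stated; level
    \<alpha> gives the second with \<open>2 * \<alpha>\<close> to spare. Both use \<alpha> \<ge>
    0.\<close>
  then show ?thesis
    using ecc_farthest_ge[OF assms(3-6), of "2 * \<alpha>"] ecc_farthest_ge[OF assms(3-6), of \<alpha>] by simp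
qed

end
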